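(* For every context-free process $P$ there exists a pushdown automaton $\mathcal{M}$ such that the transition system $\mathcal{T}(P)$ is strongly bisimilar to the pushdown process $\mathcal{T}(\mathcal{M})$.
   Context: $\mathcal{A}_\tau=\mathcal{A}\cup\{\tau\}$ is a set of action labels. $\mathrm{TSP}^{\bullet}$ process expressions: $P::=\mathbf{0}\mid\mathbf{1}\mid a.P\mid P_1\bullet P_2\mid P_1+P_2\mid N$ with $a\in\mathcal{A}_\tau$ and $N$ a name from a recursive specification (a set of equations $N\overset{\mathrm{def}}{=}P$, at most one per name, every name used being defined). A specification is guarded if every summand that is not $\mathbf{1}$ is in the scope of an action prefix. Semantics: $\mathbf{1}\downarrow$; $a.P\xrightarrow{a}P$; $P_1+P_2$ does every transition of $P_1$ and of $P_2$ and terminates if $P_1\downarrow$ or $P_2\downarrow$; $P_1\bullet P_2\downarrow$ if $P_1\downarrow$ and $P_2\downarrow$; if $P_1\xrightarrow{a}P_1'$ then $P_1\bullet P_2\xrightarrow{a}P_1'\bullet P_2$; if $P_1\downarrow$, $P_2\xrightarrow{a}P_2'$ and $P_1$ has no outgoing transitions then $P_1\bullet P_2\xrightarrow{a}P_2'$; a name has exactly the transitions and termination of the right-hand side of its defining equation. $\mathcal{T}(P)$ has as states the expressions reachable from $P$, the induced transitions, initial state $P$, and final states those with $\downarrow$. A context-free process is the strong-bisimilarity class of the transition system generated by (a name of) a finite guarded recursive specification over $\mathrm{TSP}^{\bullet}$. A pushdown automaton is a tuple $(\mathcal{S},\Sigma,\mathcal{D},\to,\uparrow,Z,\downarrow)$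 with $\mathcal{S}$ a finite set of states, $\Sigma\subseteq\mathcal{A}_\tau$ a finite set of input symbols, $\mathcal{D}$ a finite set of stack symbols, $\to\subseteq\mathcal{S}\times\mathcal{D}\times\Sigma\times\mathcal{D}^*\times\mathcal{S}$ a finite transition relation (write $s\xrightarrow{a[d/\delta]}t$), initial state $\uparrow\in\mathcal{S}$, initial stack symbol $Z\in\mathcal{D}$, and accepting states $\downarrow\subseteq\mathcal{S}$. Its pushdown process $\mathcal{T}(\mathcal{M})$ has states all pairs $(s,\delta)\in\mathcal{S}\times\mathcal{D}^*$, transitions $(s,d\delta)\xrightarrow{a}(t,\delta'\delta)$ iff $s\xrightarrow{a[d/\delta']}t$, initial state $(\uparrow,Z)$, and final states $\{(s,\delta)\mid s\in\downarrow\}$. Strong bisimilarity: a symmetric relation $R$ such that $s\,R\,t$ and $s\xrightarrow{a}s'$ imply $t\xrightarrow{a}t'$ with $s'\,R\,t'$, and $s\downarrow$ implies $t\downarrow$; two transition systems are strongly bisimilar if their initial states are so related in their disjoint union. *)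

theory Defs
  imports Main
begin

datatype 'a act = Tau | Act 'a

section \<open>Transition systems and strong bisimilarity\<close>

record ('s, 'l) lts_space =
  states :: "'s set"
  trans  :: "('s \<times> 'l \<times> 's) set"
  final  :: "'s set"

record ('s, 'l) lts = "('s, 'l) lts_space" +
  init :: 's

definition lts :: "('s, 'l) lts \<Rightarrow> bool" where
  "lts T \<longleftrightarrow> trans T \<subseteq> states T \<times> UNIV \<times> states T \<and> final T \<subseteq> states T \<and> init T \<in> states T"

definition disjoint_union ::
  "('s, 'l, 'x) lts_space_scheme \<Rightarrow> ('t, 'l, 'y) lts_space_scheme \<Rightarrow> ('s + 't, 'l) lts_space" where
  "disjoint_union T U = \<lparr>
     states = Inl ` states T \<union> Inr ` states U,
     trans = {(Inl s, a, Inl s') | s a s'. (s, a, s') \<in> trans T} \<union>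
             {(Inr u, a, Inr u') | u a u'. (u, a, u') \<in> trans U},
     final = Inl ` final T \<union> Inr ` final U \<rparr>"

definition bisimulation :: "('s, 'l, 'x) lts_space_scheme \<Rightarrow> ('s \<times> 's) set \<Rightarrow> bool" where
  "bisimulation T R \<longleftrightarrow>
     R \<subseteq> states T \<times> states T \<and> sym R \<and>
     (\<forall>(s, t) \<in> R.
        (\<forall>a s'. (s, a, s') \<in> trans T \<longrightarrow> (\<exists>t'. (t, a, t') \<in> trans T \<and> (s', t') \<in> R)) \<and>
        (s \<in> final T \<longrightarrow> t \<in> final T))"

definition strongly_bisimilar :: "('s, 'l) lts \<Rightarrow> ('t, 'l) lts \<Rightarrow> bool" where
  "strongly_bisimilar T U \<longleftrightarrow>
     (\<exists>R. bisimulation (disjoint_union T U) R \<and> (Inl (init T), Inr (init U)) \<in> R)"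

section \<open>Process expressions with sequencing\<close>

datatype (names: 'n, 'a) proc =
    Zero
  | One
  | Prefix "'a act" "('n, 'a) proc"
  | Seq "('n, 'a) proc" "('n, 'a) proc"
  | Alt "('n, 'a) proc" "('n, 'a) proc"
  | Name 'n

type_synonym ('n, 'a) spec = "'n \<rightharpoonup> ('n, 'a) proc"

definition recursive_spec :: "('n, 'a) spec \<Rightarrow> bool" where
  "recursive_spec E \<longleftrightarrow> (\<forall>P \<in> ran E. names P \<subseteq> dom E)"

text \<open>An expression is guarded if outside the scope of action prefixes it contains no name;
  \<^const>\<open>Zero\<close> is admitted as the empty sum.\<close>

fun guarded :: "('n, 'a) proc \<Rightarrow> bool" where
  "guarded Zero \<longleftrightarrow> True"
| "guarded One \<longleftrightarrow> True"
| "guarded (Prefix a P) \<longleftrightarrow> True"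
| "guarded (Seq P Q) \<longleftrightarrow> guarded P \<and> guarded Q"
| "guarded (Alt P Q) \<longleftrightarrow> guarded P \<and> guarded Q"
| "guarded (Name N) \<longleftrightarrow> False"

definition guarded_spec :: "('n, 'a) spec \<Rightarrow> bool" where
  "guarded_spec E \<longleftrightarrow> (\<forall>P \<in> ran E. guarded P)"

inductive terminates :: "('n, 'a) spec \<Rightarrow> ('n, 'a) proc \<Rightarrow> bool" for E where
  One: "terminates E One"
| AltL: "terminates E P \<Longrightarrow> terminates E (Alt P Q)"
| AltR: "terminates E Q \<Longrightarrow> terminates E (Alt P Q)"
| Seq: "terminates E P \<Longrightarrow> terminates E Q \<Longrightarrow> terminates E (Seq P Q)"
| Name: "E N = Some P \<Longrightarrow> terminates E P \<Longrightarrow> terminates E (Name N)"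

text \<open>The second rule for sequencing has the negative premise that the first component has no
  outgoing transition, so the rules are not monotone in the transition relation. They can be
  stratified: whether an expression has an outgoing transition is itself inductively definable
  without negation, because \<open>Seq P Q\<close> has one iff \<open>P\<close> has one, or \<open>P\<close> terminates and \<open>Q\<close> has
  one. For guarded specifications, lemma \<open>can_step_iff\<close> confirms that \<open>can_step\<close> means the
  existence of an outgoing transition, and \<open>step_Seq_iff\<close> gives the sequencing rules with the
  literal negative premise. (With unguarded recursion the rules may have no consistent reading,
  as for the name \<open>N\<close> defined by \<open>Alt One (Seq (Name N) (Prefix a One))\<close>.)\<close>

inductive can_step :: "('n, 'a) spec \<Rightarrow> ('n, 'a) proc \<Rightarrow> bool" for E where
  Prefix: "can_step E (Prefix a P)"
| AltL: "can_step E P \<Longrightarrow> can_step E (Alt P Q)"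
| AltR: "can_step E Q \<Longrightarrow> can_step E (Alt P Q)"
| SeqL: "can_step E P \<Longrightarrow> can_step E (Seq P Q)"
| SeqR: "terminates E P \<Longrightarrow> can_step E Q \<Longrightarrow> can_step E (Seq P Q)"
| Name: "E N = Some P \<Longrightarrow> can_step E P \<Longrightarrow> can_step E (Name N)"

inductive step :: "('n, 'a) spec \<Rightarrow> ('n, 'a) proc \<Rightarrow> 'a act \<Rightarrow> ('n, 'a) proc \<Rightarrow> bool" for E where
  Prefix: "step E (Prefix a P) a P"
| AltL: "step E P a P' \<Longrightarrow> step E (Alt P Q) a P'"
| AltR: "step E Q a Q' \<Longrightarrow> step E (Alt P Q) a Q'"
| SeqL: "step E P a P' \<Longrightarrow> step E (Seq P Q) a (Seq P' Q)"
| SeqR: "terminates E P \<Longrightarrow> \<not> can_step E P \<Longrightarrow> step E Q a Q' \<Longrightarrow> step E (Seq P Q) a Q'"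
| Name: "E N = Some P \<Longrightarrow> step E P a P' \<Longrightarrow> step E (Name N) a P'"

lemma can_step_iff:
  assumes "guarded_spec E"
  shows "can_step E P \<longleftrightarrow> (\<exists>a P'. step E P a P')"
proof
  have guarded_case: "\<exists>a P'. step E P a P'" if "can_step E P" "guarded P" for P
    using that
  proof (induction P rule: proc.induct)
    case (Seq P Q)
    from Seq.prems(1) show ?case
    proof cases
      case SeqL
      with Seq.IH(1) Seq.prems show ?thesis by (auto intro: step.SeqL)
    next
      case SeqR
      with Seq.IH Seq.prems show ?thesis
        by (cases "can_step E P") (auto intro: step.SeqL step.SeqR)
    qed
  qed (auto elim: can_step.cases intro: step.intros)
  assume "can_step E P"
  then show "\<exists>a P'. step E P a P'"
  proof (induction P rule: proc.induct)
    case (Seq P Q)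
    from Seq.prems show ?case
    proof cases
      case SeqL
      with Seq.IH(1) show ?thesis by (auto intro: step.SeqL)
    next
      case SeqR
      with Seq.IH show ?thesis
        by (cases "can_step E P") (auto intro: step.SeqL step.SeqR)
    qed
  next
    case (Alt P Q)
    from Alt.prems show ?case
      by cases (use Alt.IH in \<open>auto intro: step.AltL step.AltR\<close>)
  next
    case (Name N)
    from Name.prems obtain P where P: "E N = Some P" "can_step E P"
      by (auto elim: can_step.cases)
    with assms have "guarded P" by (auto simp: guarded_spec_def ran_def)
    with P guarded_case show ?case by (blast intro: step.Name)
  qed (auto elim: can_step.cases intro: step.Prefix)
next
  assume "\<exists>a P'. step E P a P'"
  then obtain a P' where "step E P a P'" by blast
  then show "can_step E P"
    by induction (auto intro: can_step.intros)
qed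

lemma step_Seq_iff:
  assumes "guarded_spec E"
  shows "step E (Seq P Q) a R \<longleftrightarrow>
     (\<exists>P'. step E P a P' \<and> R = Seq P' Q) \<or>
     (terminates E P \<and> (\<nexists>b P'. step E P b P') \<and> step E Q a R)"
  by (subst step.simps) (auto simp: can_step_iff[OF assms])

definition reachable :: "('n, 'a) spec \<Rightarrow> ('n, 'a) proc \<Rightarrow> ('n, 'a) proc set" where
  "reachable E P = {Q. (\<lambda>Q Q'. \<exists>a. step E Q a Q')\<^sup>*\<^sup>* P Q}"

definition proc_lts :: "('n, 'a) spec \<Rightarrow> ('n, 'a) proc \<Rightarrow> (('n, 'a) proc, 'a act) lts" where
  "proc_lts E P = \<lparr>
     states = reachable E P,
     trans = {(Q, a, Q'). Q \<in> reachable E P \<and> step E Q a Q'},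
     final = {Q \<in> reachable E P. terminates E Q},
     init = P \<rparr>"

lemma lts_proc_lts: "lts (proc_lts E P)"
  by (auto simp: lts_def proc_lts_def reachable_def intro: rtranclp.rtrancl_into_rtrancl)

text \<open>A context-free process is a strong bisimilarity class; the predicate holds for its members.
  The type argument fixes the type from which the names of the specification are drawn.\<close>

definition context_free_process :: "'n itself \<Rightarrow> ('s, 'a act) lts \<Rightarrow> bool" where
  "context_free_process n T \<longleftrightarrow> lts T \<and>
     (\<exists>(E :: ('n, 'a) spec) N.
        recursive_spec E \<and> finite (dom E) \<and> guarded_spec E \<and> N \<in> dom E \<and>
        strongly_bisimilar T (proc_lts E (Name N)))"

lemma strongly_bisimilar_refl:
  assumes "lts T"
  shows "strongly_bisimilar T T"
proof -
  let ?R = "{(Inl s, Inr s) | s. s \<in> states T} \<union> {(Inr s, Inl s) | s. s \<in> states T}"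
  have "bisimulation (disjoint_union T T) ?R"
    using assms by (fastforce simp: bisimulation_def disjoint_union_def lts_def sym_def)
  moreover have "(Inl (init T), Inr (init T)) \<in> ?R"
    using assms by (auto simp: lts_def)
  ultimately show ?thesis
    unfolding strongly_bisimilar_def by blast
qed

lemma context_free_process_proc_lts:
  fixes E :: "('n, 'a) spec"
  assumes "recursive_spec E" "finite (dom E)" "guarded_spec E" "N \<in> dom E"
  shows "context_free_process TYPE('n) (proc_lts E (Name N))"
  using assms strongly_bisimilar_refl[OF lts_proc_lts] lts_proc_lts
  unfolding context_free_process_def by blast

section \<open>Pushdown automata\<close>

record ('q, 'a, 'd) pda =
  pda_states :: "'q set"
  pda_inputs :: "'a act set"
  pda_stack  :: "'d set"
  pda_trans  :: "('q \<times> 'd \<times> 'a act \<times> 'd list \<times> 'q) set"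
  pda_init   :: 'q
  pda_bottom :: 'd
  pda_accept :: "'q set"

definition pushdown_automaton :: "('q, 'a, 'd) pda \<Rightarrow> bool" where
  "pushdown_automaton M \<longleftrightarrow>
     finite (pda_states M) \<and> finite (pda_inputs M) \<and> finite (pda_stack M) \<and>
     finite (pda_trans M) \<and>
     pda_trans M \<subseteq>
       pda_states M \<times> pda_stack M \<times> pda_inputs M \<times> lists (pda_stack M) \<times> pda_states M \<and>
     pda_init M \<in> pda_states M \<and> pda_bottom M \<in> pda_stack M \<and> pda_accept M \<subseteq> pda_states M"

definition pda_lts :: "('q, 'a, 'd) pda \<Rightarrow> ('q \<times> 'd list, 'a act) lts" where
  "pda_lts M = \<lparr>
     states = pda_states M \<times> lists (pda_stack M),
     trans = {((s, d # \<delta>), a, (t, \<delta>' @ \<delta>)) | s d \<delta> a t \<delta>'.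
                (s, d, a, \<delta>', t) \<in> pda_trans M \<and> \<delta> \<in> lists (pda_stack M)},
     final = pda_accept M \<times> lists (pda_stack M),
     init = (pda_init M, [pda_bottom M]) \<rparr>"

lemma lts_pda_lts: "pushdown_automaton M \<Longrightarrow> lts (pda_lts M)"
  by (fastforce simp: lts_def pda_lts_def pushdown_automaton_def)

end

theory Submission
  imports Defs
begin

text \<open>An expression reachable from a name is a left-nested sequence
  \<open>(\<dots>(P \<bullet> Q\<^sub>1)\<bullet> \<dots>) \<bullet> Q\<^sub>k\<close> in which all \<open>Q\<^sub>i\<close> are subexpressions of the specification. It is
  represented by a stack of these components. Components that terminate without being able to
  move are neutral for sequencing and are left out, so that the topmost component is always the
  one that moves, even though the automaton has no silent moves to discard others. A sequence
  terminates iff all its components do; to let the control state record this, every stack symbol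
  carries a bit telling whether all components below it terminate.\<close>

section \<open>Bisimulations between two transition systems\<close>

text \<open>A relation from one system to the other, with a backward clause in place of symmetry on
  the disjoint union. Relations of this form compose.\<close>

definition cross_bisimulation ::
  "('s, 'l) lts \<Rightarrow> ('t, 'l) lts \<Rightarrow> ('s \<times> 't) set \<Rightarrow> bool" where
  "cross_bisimulation T U B \<longleftrightarrow> B \<subseteq> states T \<times> states U \<and>
     (\<forall>s u. (s, u) \<in> B \<longrightarrow>
        (\<forall>a s'. (s, a, s') \<in> trans T \<longrightarrow> (\<exists>u'. (u, a, u') \<in> trans U \<and> (s', u') \<in> B)) \<and>
        (\<forall>a u'. (u, a, u') \<in> trans U \<longrightarrow> (\<exists>s'. (s, a, s') \<in> trans T \<and> (s', u') \<in> B)) \<and>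
        (s \<in> final T \<longleftrightarrow> u \<in> final U))"

lemma strongly_bisimilar_iff:
  "strongly_bisimilar T U \<longleftrightarrow> (\<exists>B. cross_bisimulation T U B \<and> (init T, init U) \<in> B)"
proof
  assume "strongly_bisimilar T U"
  then obtain R where R: "bisimulation (disjoint_union T U) R" "(Inl (init T), Inr (init U)) \<in> R"
    unfolding strongly_bisimilar_def by blast
  let ?B = "{(s, u). (Inl s, Inr u) \<in> R}"
  have move: "\<exists>y'. (y, a, y') \<in> trans (disjoint_union T U) \<and> (x', y') \<in> R"
    if "(x, y) \<in> R" "(x, a, x') \<in> trans (disjoint_union T U)" for x y a x'
    using R(1) that unfolding bisimulation_def by blast
  have fin: "y \<in> final (disjoint_union T U)" if "(x, y) \<in> R" "x \<in> final (disjoint_union T U)" for x y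
    using R(1) that unfolding bisimulation_def by blast
  have sym: "(y, x) \<in> R" if "(x, y) \<in> R" for x y
    using R(1) that unfolding bisimulation_def by (meson symD)
  have "cross_bisimulation T U ?B"
    unfolding cross_bisimulation_def
  proof (intro conjI allI impI)
    show "?B \<subseteq> states T \<times> states U"
      using R(1) by (auto simp: bisimulation_def disjoint_union_def)
  next
    fix s u a s' assume "(s, u) \<in> ?B" "(s, a, s') \<in> trans T"
    then show "\<exists>u'. (u, a, u') \<in> trans U \<and> (s', u') \<in> ?B"
      using move[of "Inl s" "Inr u" a "Inl s'"] by (auto simp: disjoint_union_def)
  next
    fix s u a u' assume "(s, u) \<in> ?B" "(u, a, u') \<in> trans U"
    then show "\<exists>s'. (s, a, s') \<in> trans T \<and> (s', u') \<in> ?B"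
      using move[of "Inr u" "Inl s" a "Inr u'"] by (auto simp: disjoint_union_def dest: sym)
  next
    fix s u assume "(s, u) \<in> ?B"
    then show "s \<in> final T \<longleftrightarrow> u \<in> final U"
      using fin[of "Inl s" "Inr u"] fin[of "Inr u" "Inl s"] sym
      by (auto simp: disjoint_union_def)
  qed
  with R(2) show "\<exists>B. cross_bisimulation T U B \<and> (init T, init U) \<in> B" by blast
next
  assume "\<exists>B. cross_bisimulation T U B \<and> (init T, init U) \<in> B"
  then obtain B where B: "cross_bisimulation T U B" "(init T, init U) \<in> B" by blast
  let ?R = "{(Inl s, Inr u) | s u. (s, u) \<in> B} \<union> {(Inr u, Inl s) | s u. (s, u) \<in> B}"
  have "bisimulation (disjoint_union T U) ?R"
    unfolding bisimulation_def
  proof (intro conjI)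
    show "?R \<subseteq> states (disjoint_union T U) \<times> states (disjoint_union T U)"
      using B(1) by (auto simp: cross_bisimulation_def disjoint_union_def)
    show "sym ?R" by (auto simp: sym_def)
    show "\<forall>(s, t) \<in> ?R.
        (\<forall>a s'. (s, a, s') \<in> trans (disjoint_union T U) \<longrightarrow>
           (\<exists>t'. (t, a, t') \<in> trans (disjoint_union T U) \<and> (s', t') \<in> ?R)) \<and>
        (s \<in> final (disjoint_union T U) \<longrightarrow> t \<in> final (disjoint_union T U))"
      using B(1) by (fastforce simp: cross_bisimulation_def disjoint_union_def)
  qed
  with B(2) show "strongly_bisimilar T U"
    unfolding strongly_bisimilar_def by blast
qed

text \<open>A context-free process is given only up to bisimilarity with the system of a
  specification, so the automaton for the specification is reached in two steps.\<close>

lemma strongly_bisimilar_trans: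
  assumes "strongly_bisimilar T U" "strongly_bisimilar U V"
  shows "strongly_bisimilar T V"
proof -
  from assms obtain B C where
    B: "cross_bisimulation T U B" "(init T, init U) \<in> B" and
    C: "cross_bisimulation U V C" "(init U, init V) \<in> C"
    by (auto simp: strongly_bisimilar_iff)
  have "cross_bisimulation T V (B O C)"
    unfolding cross_bisimulation_def
  proof (intro conjI allI impI)
    show "B O C \<subseteq> states T \<times> states V"
      using B(1) C(1) by (auto simp: cross_bisimulation_def)
  next
    fix s v a s' assume "(s, v) \<in> B O C" and s': "(s, a, s') \<in> trans T"
    then obtain u where "(s, u) \<in> B" "(u, v) \<in> C" by blast
    moreover from this s' B(1) obtain u' where "(u, a, u') \<in> trans U" "(s', u') \<in> B"
      unfolding cross_bisimulation_def by blast
    moreover from this \<open>(u, v) \<in> C\<close> C(1) obtain v' where "(v, a, v') \<in> trans V" "(u', v') \<in> C"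
      unfolding cross_bisimulation_def by blast
    ultimately show "\<exists>v'. (v, a, v') \<in> trans V \<and> (s', v') \<in> B O C" by blast
  next
    fix s v a v' assume "(s, v) \<in> B O C" and v': "(v, a, v') \<in> trans V"
    then obtain u where "(s, u) \<in> B" "(u, v) \<in> C" by blast
    moreover from this v' C(1) obtain u' where "(u, a, u') \<in> trans U" "(u', v') \<in> C"
      unfolding cross_bisimulation_def by blast
    moreover from this \<open>(s, u) \<in> B\<close> B(1) obtain s' where "(s, a, s') \<in> trans T" "(s', u') \<in> B"
      unfolding cross_bisimulation_def by blast
    ultimately show "\<exists>s'. (s, a, s') \<in> trans T \<and> (s', v') \<in> B O C" by blast
  next
    fix s v assume "(s, v) \<in> B O C"
    then obtain u where "(s, u) \<in> B" "(u, v) \<in> C" by blast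
    then show "s \<in> final T \<longleftrightarrow> v \<in> final V"
      using B(1) C(1) unfolding cross_bisimulation_def by blast
  qed
  with B(2) C(2) show ?thesis
    by (auto simp: strongly_bisimilar_iff)
qed

section \<open>The stack of an expression\<close>

definition inert :: "('n, 'a) spec \<Rightarrow> ('n, 'a) proc \<Rightarrow> bool" where
  "inert E P \<longleftrightarrow> terminates E P \<and> \<not> can_step E P"

definition component :: "('n, 'a) spec \<Rightarrow> ('n, 'a) proc \<Rightarrow> ('n, 'a) proc list" where
  "component E P = (if inert E P then [] else [P])"

text \<open>Only left operands are decomposed: \<open>step.SeqL\<close> rewrites the left operand
  and copies the right one unchanged, so a right operand can serve as one stack symbol.\<close>

fun components :: "('n, 'a) spec \<Rightarrow> ('n, 'a) proc \<Rightarrow> ('n, 'a) proc list" where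
  "components E (Seq P Q) = components E P @ component E Q"
| "components E P = component E P"

inductive_simps terminates_Seq_iff: "terminates E (Seq P Q)"

inductive_simps can_step_Seq_iff: "can_step E (Seq P Q)"

inductive_simps step_iffs:
  "step E Zero a P'"
  "step E One a P'"
  "step E (Prefix b P) a P'"
  "step E (Alt P Q) a P'"
  "step E (Name N) a P'"

lemma inert_Seq_iff: "inert E (Seq P Q) \<longleftrightarrow> inert E P \<and> inert E Q"
  by (auto simp: inert_def terminates_Seq_iff can_step_Seq_iff)

lemma step_not_inert: "guarded_spec E \<Longrightarrow> step E P a P' \<Longrightarrow> \<not> inert E P"
  using can_step_iff unfolding inert_def by blast

lemma components_eq_Nil_iff: "components E P = [] \<longleftrightarrow> inert E P"
  by (induction P) (auto simp: component_def inert_Seq_iff)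

text \<open>Dropping inert components does no harm here, because they terminate by
  definition.\<close>

lemma terminates_iff_components: "terminates E P \<longleftrightarrow> list_all (terminates E) (components E P)"
  by (induction P) (auto simp: component_def inert_def terminates_Seq_iff)

text \<open>In a sequence, a step of the left operand leaves the right one at the bottom of
  \<open>rest\<close>. In the \<open>SeqR\<close> case the left operand is inert and contributes
  nothing, and the right operand, being able to move, is the only component.\<close>

lemma components_step:
  assumes "guarded_spec E" "step E P a P'"
  shows "\<exists>Q Q' rest. components E P = Q # rest \<and> step E Q a Q' \<and>
    components E P' = components E Q' @ rest"
  using assms(2)
proof (induction P arbitrary: P')
  case (Seq P Q)
  from Seq.prems show ?case
  proof cases
    case (SeqL P1)
    with Seq.IH(1) show ?thesis by fastforce
  next
    case SeqR
    then have "components E P = []" by (simp add: components_eq_Nil_iff inert_def)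
    then show ?thesis using SeqR step_not_inert[OF assms(1)] by (auto simp: component_def)
  qed
qed (use step_not_inert[OF assms(1)] in \<open>auto simp: component_def\<close>)

text \<open>An empty component list of the left operand means inertness, which is exactly the two
  side premises of \<open>step.SeqR\<close>. A nonempty list has the moving component on top, and
  \<open>step.SeqL\<close> applies.\<close>

lemma step_of_components:
  assumes "components E P = Q # rest" "step E Q a Q'"
  shows "\<exists>P'. step E P a P' \<and> components E P' = components E Q' @ rest"
  using assms(1)
proof (induction P arbitrary: rest)
  case (Seq P1 P2)
  show ?case
  proof (cases "components E P1")
    case Nil
    then have "inert E P1" by (simp add: components_eq_Nil_iff)
    moreover have "P2 = Q" "rest = []"
      using Seq.prems Nil by (auto simp: component_def split: if_splits)
    ultimately show ?thesis
      using assms(2) by (auto simp: inert_def intro: step.SeqR)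
  next
    case (Cons X r)
    with Seq.prems have "components E P1 = Q # r" "rest = r @ component E P2" by auto
    with Seq.IH(1) obtain P' where "step E P1 a P'" "components E P' = components E Q' @ r"
      by blast
    with \<open>rest = _\<close> show ?thesis by (fastforce intro: step.SeqL)
  qed
qed (use assms(2) in \<open>auto simp: component_def split: if_splits\<close>)

section \<open>Finiteness\<close>

fun subexprs :: "('n, 'a) proc \<Rightarrow> ('n, 'a) proc set" where
  "subexprs (Prefix a P) = insert (Prefix a P) (subexprs P)"
| "subexprs (Seq P Q) = insert (Seq P Q) (subexprs P \<union> subexprs Q)"
| "subexprs (Alt P Q) = insert (Alt P Q) (subexprs P \<union> subexprs Q)"
| "subexprs P = {P}"

lemma finite_subexprs: "finite (subexprs P)"
  by (induction P) auto

lemma subexprs_refl: "P \<in> subexprs P"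
  by (cases P) auto

lemma subexprs_trans: "P \<in> subexprs Q \<Longrightarrow> subexprs P \<subseteq> subexprs Q"
  by (induction Q) auto

lemma components_subset_subexprs: "set (components E P) \<subseteq> subexprs P"
proof (induction P)
  case (Seq P Q)
  then show ?case using subexprs_refl[of Q] by (auto simp: component_def)
qed (auto simp: component_def)

text \<open>A step descends into subexpressions or unfolds names, and unfolding contributes only
  subexpressions of right-hand sides. This bounds the stack alphabet.\<close>

lemma components_step_subset:
  assumes "step E P a P'"
  shows "set (components E P') \<subseteq> subexprs P \<union> (\<Union>Q \<in> ran E. subexprs Q)"
  using assms
proof induction
  case (Prefix a P)
  then show ?case using components_subset_subexprs by fastforce
next
  case (SeqL P a P' Q)
  then show ?case using subexprs_refl[of Q] by (auto simp: component_def)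
next
  case (Name N P a P')
  then have "P \<in> ran E" by (auto simp: ran_def)
  with Name.IH show ?case by auto
qed auto

text \<open>Unfolding a name does not yield a smaller expression, so structural induction alone
  fails. Finite branching is shown first for guarded expressions, where no name has to be unfolded;
  a name then unfolds once to a guarded expression.\<close>

lemma finite_steps:
  assumes "guarded_spec E"
  shows "finite {(a, P'). step E P a P'}"
proof -
  have prefix: "{(b, P'). step E (Prefix a P) b P'} = {(a, P)}"
    for a :: "'b act" and P :: "('a, 'b) proc"
    by (auto simp: step_iffs)
  have alt: "{(b, P'). step E (Alt P Q) b P'} = {(b, P'). step E P b P'} \<union> {(b, P'). step E Q b P'}"
    for P Q by (auto simp: step_iffs)
  have seq: "{(b, P'). step E (Seq P Q) b P'} \<subseteq>
      (\<lambda>(b, P'). (b, Seq P' Q)) ` {(b, P'). step E P b P'} \<union> {(b, P'). step E Q b P'}" for P Q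
    by (auto simp: step_Seq_iff[OF assms])
  have none: "{(b, P'). step E Zero b P'} = {}" "{(b, P'). step E One b P'} = {}"
    by (auto simp: step_iffs)
  have guarded_case: "finite {(a, P'). step E P a P'}" if "guarded P" for P
    using that
  proof (induction P)
    case (Seq P Q)
    then show ?case by (intro finite_subset[OF seq]) auto
  qed (simp_all add: prefix alt none)
  show ?thesis
  proof (induction P)
    case (Seq P Q)
    then show ?case by (intro finite_subset[OF seq]) auto
  next
    case (Name N)
    show ?case
    proof (cases "E N")
      case None
      then have "{(a, P'). step E (Name N) a P'} = {}" by (simp add: step_iffs)
      then show ?thesis by simp
    next
      case (Some P)
      then have "{(a, P'). step E (Name N) a P'} = {(a, P'). step E P a P'}"
        by (simp add: step_iffs)
      moreover have "guarded P" using Some assms by (auto simp: guarded_spec_def ran_def)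
      ultimately show ?thesis using guarded_case by simp
    qed
  qed (simp_all add: prefix alt none)
qed

section \<open>The pushdown automaton of a specification\<close>

text \<open>The argument \<open>b\<close> stands for the part of the stack below the list; the bit
  of a symbol excludes the symbol itself.\<close>

fun annotate ::
  "('n, 'a) spec \<Rightarrow> bool \<Rightarrow> ('n, 'a) proc list \<Rightarrow> (('n, 'a) proc \<times> bool) list" where
  "annotate E b [] = []"
| "annotate E b (P # Ps) = (P, b \<and> list_all (terminates E) Ps) # annotate E b Ps"

text \<open>Replacing what lies above \<open>Qs\<close> leaves the bits in \<open>Qs\<close> intact,
  so a move that sees only the top symbol can keep the whole annotation correct.\<close>

lemma annotate_append:
  "annotate E b (Ps @ Qs) =
    annotate E (b \<and> list_all (terminates E) Qs) Ps @ annotate E b Qs"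
  by (induction Ps) auto

lemma set_annotate: "set (annotate E b Ps) \<subseteq> set Ps \<times> UNIV"
  by (induction Ps) auto

definition alphabet :: "('n, 'a) spec \<Rightarrow> 'n \<Rightarrow> ('n, 'a) proc set" where
  "alphabet E N = insert (Name N) (\<Union>Q \<in> ran E. subexprs Q)"

lemma finite_alphabet: "finite (dom E) \<Longrightarrow> finite (alphabet E N)"
  by (simp add: alphabet_def finite_subexprs finite_ran)

lemma components_step_alphabet:
  assumes "Q \<in> alphabet E N" "step E Q a Q'"
  shows "set (components E Q') \<subseteq> alphabet E N"
proof -
  have "subexprs Q \<subseteq> alphabet E N"
    using assms(1) subexprs_trans by (fastforce simp: alphabet_def)
  with components_step_subset[OF assms(2)] show ?thesis by (auto simp: alphabet_def)
qed

text \<open>Control state 1 records that the represented expression terminates. The target state can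
  be computed from the popped symbol, whose bit \<open>b\<close> summarises everything below it. The
  map \<open>f\<close> codes symbols as numbers, and the bottom symbol has bit \<open>True\<close>
  because nothing lies below it.\<close>

definition spec_pda ::
  "(('n, 'a) proc \<times> bool \<Rightarrow> nat) \<Rightarrow> ('n, 'a) spec \<Rightarrow> 'n \<Rightarrow> (nat, 'a, nat) pda" where
  "spec_pda f E N = \<lparr>
     pda_states = {0, 1},
     pda_inputs = {a. \<exists>Q \<in> alphabet E N. \<exists>Q'. step E Q a Q'},
     pda_stack = f ` (alphabet E N \<times> UNIV),
     pda_trans = {(s, f (Q, b), a, map f (annotate E b (components E Q')),
         of_bool (b \<and> terminates E Q')) | s Q b a Q'.
         s \<in> {0, 1} \<and> Q \<in> alphabet E N \<and> step E Q a Q'},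
     pda_init = of_bool (terminates E (Name N)),
     pda_bottom = f (Name N, True),
     pda_accept = {1} \<rparr>"

definition config ::
  "(('n, 'a) proc \<times> bool \<Rightarrow> nat) \<Rightarrow> ('n, 'a) spec \<Rightarrow> ('n, 'a) proc \<Rightarrow> nat \<times> nat list" where
  "config f E P = (of_bool (terminates E P), map f (annotate E True (components E P)))"

lemma pushdown_automaton_spec_pda:
  assumes "finite (dom E)" "guarded_spec E"
  shows "pushdown_automaton (spec_pda f E N)"
proof -
  \<comment> \<open>Finite branching over a finite alphabet makes this set finite; the inputs are an
    image of it, and the moves are covered by an image of its product with the states and
    bits.\<close>
  let ?S = "SIGMA Q:alphabet E N. {(a, Q'). step E Q a Q'}"
  have fin: "finite ?S"
    using finite_alphabet[OF assms(1)] finite_steps[OF assms(2)] by blast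
  have "pda_inputs (spec_pda f E N) = (\<lambda>(Q, a, Q'). a) ` ?S"
    by (force simp: spec_pda_def)
  then have 1: "finite (pda_inputs (spec_pda f E N))" using fin by simp
  let ?g = "\<lambda>(s, b, Q, a, Q'). (s, f (Q, b), a, map f (annotate E b (components E Q')),
    of_bool (b \<and> terminates E Q') :: nat)"
  have "pda_trans (spec_pda f E N) \<subseteq> ?g ` ({0, 1} \<times> UNIV \<times> ?S)"
  proof
    fix x assume "x \<in> pda_trans (spec_pda f E N)"
    then obtain s Q b a Q' where
      "x = ?g (s, b, Q, a, Q')" "s \<in> {0, 1}" "Q \<in> alphabet E N" "step E Q a Q'"
      unfolding spec_pda_def by simp blast
    then show "x \<in> ?g ` ({0, 1} \<times> UNIV \<times> ?S)"
      by (intro image_eqI[of _ _ "(s, b, Q, a, Q')"]) simp_all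
  qed
  then have 2: "finite (pda_trans (spec_pda f E N))"
    by (rule finite_subset) (use fin in simp)
  have 3: "f x \<in> f ` (alphabet E N \<times> UNIV)"
    if "Q \<in> alphabet E N" "step E Q a Q'" "x \<in> set (annotate E b (components E Q'))"
    for b Q a Q' x
    using components_step_alphabet[OF that(1,2)] set_annotate[of E b "components E Q'"] that(3)
    by blast
  have "pda_trans (spec_pda f E N) \<subseteq>
       pda_states (spec_pda f E N) \<times> pda_stack (spec_pda f E N) \<times> pda_inputs (spec_pda f E N) \<times>
       lists (pda_stack (spec_pda f E N)) \<times> pda_states (spec_pda f E N)"
    by (auto simp: spec_pda_def intro: 3)
  moreover have "Name N \<in> alphabet E N" by (simp add: alphabet_def)
  ultimately show ?thesis
    unfolding pushdown_automaton_def using 1 2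
    by (intro conjI) (auto simp: spec_pda_def finite_alphabet[OF assms(1)])
qed

lemma components_reachable_alphabet:
  assumes "guarded_spec E" "P \<in> reachable E (Name N)"
  shows "set (components E P) \<subseteq> alphabet E N"
proof -
  from assms(2) have "(\<lambda>Q Q'. \<exists>a. step E Q a Q')\<^sup>*\<^sup>* (Name N) P" by (simp add: reachable_def)
  then show ?thesis
  proof induction
    case base
    show ?case by (auto simp: component_def alphabet_def)
  next
    case (step P P')
    then obtain a where "step E P a P'" by blast
    from components_step[OF assms(1) this] obtain Q Q' rest where
      "components E P = Q # rest" "step E Q a Q'" "components E P' = components E Q' @ rest"
      by blast
    with step.IH show ?case using components_step_alphabet by fastforce
  qed
qed

lemma config_in_states:
  assumes "set (components E P) \<subseteq> alphabet E N"
  shows "config f E P \<in> states (pda_lts (spec_pda f E N))"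
  using assms set_annotate[of E True "components E P"]
  by (fastforce simp: config_def pda_lts_def spec_pda_def)

text \<open>The bit of a component lying on \<open>rest\<close> is
  \<open>list_all (terminates E) rest\<close>, so this is the form in which a move replacing that
  component produces the new configuration.\<close>

lemma config_of_components:
  assumes "components E P = components E Q @ rest"
  shows "config f E P = (of_bool (list_all (terminates E) rest \<and> terminates E Q),
    map f (annotate E (list_all (terminates E) rest) (components E Q)) @
    map f (annotate E True rest))"
  using terminates_iff_components[of E P] terminates_iff_components[of E Q] assms
  by (auto simp: config_def annotate_append)

lemma config_step:
  assumes "guarded_spec E" "set (components E P) \<subseteq> alphabet E N" "step E P a P'"
  shows "(config f E P, a, config f E P') \<in> trans (pda_lts (spec_pda f E N))"
proof -
  from components_step[OF assms(1,3)] obtain Q Q' rest where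
    Q: "components E P = Q # rest" "step E Q a Q'" "components E P' = components E Q' @ rest"
    by blast
  have "map f (annotate E True rest) \<in> lists (f ` (alphabet E N \<times> UNIV))"
    using assms(2) Q(1) set_annotate[of E True rest] by fastforce
  moreover have "Q \<in> alphabet E N" using assms(2) Q(1) by simp
  moreover have "config f E P = (of_bool (terminates E P),
      f (Q, list_all (terminates E) rest) # map f (annotate E True rest))"
    by (simp add: config_def Q(1))
  ultimately show ?thesis
    using Q(2) by (fastforce simp: config_of_components[OF Q(3)] pda_lts_def spec_pda_def)
qed

lemma step_of_config:
  assumes "inj_on f (alphabet E N \<times> UNIV)" "set (components E P) \<subseteq> alphabet E N"
    and "(config f E P, a, c) \<in> trans (pda_lts (spec_pda f E N))"
  shows "\<exists>P'. step E P a P' \<and> c = config f E P'"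
proof -
  from assms(3) obtain X b X' \<delta> where
    X: "snd (config f E P) = f (X, b) # \<delta>" "X \<in> alphabet E N" "step E X a X'"
    "c = (of_bool (b \<and> terminates E X'), map f (annotate E b (components E X')) @ \<delta>)"
    by (auto simp: pda_lts_def spec_pda_def)
  from X(1) obtain Q rest where comps: "components E P = Q # rest"
    by (cases "components E P") (auto simp: config_def)
  have "f (Q, list_all (terminates E) rest) = f (X, b)"
    and \<delta>: "\<delta> = map f (annotate E True rest)"
    using X(1) by (auto simp: config_def comps)
  \<comment> \<open>The codes can be compared because both \<open>X\<close> and \<open>Q\<close> lie
    in the alphabet, where \<open>f\<close> is injective.\<close>
  then have eq: "X = Q" "b = list_all (terminates E) rest"
    using inj_onD[OF assms(1)] assms(2) comps X(2) by fastforce+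
  from step_of_components[OF comps] X(3) obtain P' where
    "step E P a P'" "components E P' = components E X' @ rest"
    unfolding eq by blast
  then show ?thesis
    using config_of_components[of E P' X' rest f] by (auto simp: X(4) eq \<delta>)
qed

lemma strongly_bisimilar_spec_pda:
  assumes "guarded_spec E" "inj_on f (alphabet E N \<times> UNIV)"
  shows "strongly_bisimilar (proc_lts E (Name N)) (pda_lts (spec_pda f E N))"
proof -
  let ?T = "proc_lts E (Name N)" and ?M = "pda_lts (spec_pda f E N)"
  \<comment> \<open>The graph of \<open>config\<close> suffices: moves of the automaton from such
    configurations lead to such configurations again.\<close>
  let ?B = "{(P, config f E P) | P. P \<in> reachable E (Name N)}"
  have reach: "P' \<in> reachable E (Name N)" if "P \<in> reachable E (Name N)" "step E P a P'" for P a P'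
    using that by (auto simp: reachable_def intro: rtranclp.rtrancl_into_rtrancl)
  note sub = components_reachable_alphabet[OF assms(1)]
  have fin: "config f E P \<in> final ?M \<longleftrightarrow> terminates E P" if "P \<in> reachable E (Name N)" for P
    using config_in_states[OF sub[OF that], of f]
    by (auto simp: config_def pda_lts_def spec_pda_def)
  have start: "Name N \<in> reachable E (Name N)" by (simp add: reachable_def)
  have B: "cross_bisimulation ?T ?M ?B"
    unfolding cross_bisimulation_def
  proof (intro conjI allI impI)
    show "?B \<subseteq> states ?T \<times> states ?M"
      using config_in_states[OF sub] by (auto simp: proc_lts_def)
  next
    fix P c a P' assume "(P, c) \<in> ?B" "(P, a, P') \<in> trans ?T"
    then have "c = config f E P" "P \<in> reachable E (Name N)" "step E P a P'"
      by (auto simp: proc_lts_def)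
    then show "\<exists>c'. (c, a, c') \<in> trans ?M \<and> (P', c') \<in> ?B"
      using config_step[OF assms(1) sub] reach by blast
  next
    fix P c a c' assume "(P, c) \<in> ?B" "(c, a, c') \<in> trans ?M"
    then have P: "P \<in> reachable E (Name N)" and "(config f E P, a, c') \<in> trans ?M" by auto
    with step_of_config[OF assms(2) sub] obtain P' where "step E P a P'" "c' = config f E P'"
      by blast
    with P show "\<exists>P'. (P, a, P') \<in> trans ?T \<and> (P', c') \<in> ?B"
      using reach by (auto simp: proc_lts_def)
  next
    fix P c assume "(P, c) \<in> ?B"
    then show "P \<in> final ?T \<longleftrightarrow> c \<in> final ?M"
      using fin by (auto simp: proc_lts_def)
  qed
  show ?thesis
  proof (cases "inert E (Name N)")
    case False
    then have "init ?M = config f E (Name N)"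
      by (simp add: config_def component_def pda_lts_def spec_pda_def)
    then show ?thesis
      using B start by (auto simp: strongly_bisimilar_iff proc_lts_def)
  next
    \<comment> \<open>Here the initial stack is not the empty stack of the inert expression, but neither side
      can move.\<close>
    case True
    then have no_step: "\<not> step E (Name N) a P'" for a P'
      using can_step_iff[OF assms(1)] by (auto simp: inert_def)
    \<comment> \<open>By injectivity the bottom symbol codes no expression of the alphabet other
      than \<open>Name N\<close>, which has no step.\<close>
    then have "(init ?M, a, c) \<notin> trans ?M" for a c
      using inj_onD[OF assms(2)]
      by (fastforce simp: pda_lts_def spec_pda_def alphabet_def)
    moreover have "init ?M \<in> final ?M" "init ?M \<in> states ?M"
      using True by (auto simp: inert_def pda_lts_def spec_pda_def alphabet_def)
    ultimately have "cross_bisimulation ?T ?M {(Name N, init ?M)}"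
      using True no_step start by (auto simp: cross_bisimulation_def proc_lts_def inert_def)
    then show ?thesis
      by (auto simp: strongly_bisimilar_iff proc_lts_def)
  qed
qed

theorem theorem2:
  fixes P :: "('s, 'a act) lts"
  assumes "context_free_process TYPE('n) P"
  shows "\<exists>M :: (nat, 'a, nat) pda. pushdown_automaton M \<and> strongly_bisimilar P (pda_lts M)"
proof -
  from assms obtain E :: "('n, 'a) spec" and N where
    E: "finite (dom E)" "guarded_spec E" "strongly_bisimilar P (proc_lts E (Name N))"
    unfolding context_free_process_def by blast
  have "finite (alphabet E N \<times> (UNIV :: bool set))"
    using finite_alphabet[OF E(1)] by simp
  \<comment> \<open>A finite alphabet embeds into the natural numbers, which gives the automaton a
    stack type independent of the specification.\<close>
  then obtain f :: "('n, 'a) proc \<times> bool \<Rightarrow> nat" where "inj_on f (alphabet E N \<times> UNIV)"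
    using finite_imp_inj_to_nat_seg by blast
  then have "strongly_bisimilar P (pda_lts (spec_pda f E N))"
    using strongly_bisimilar_trans[OF E(3) strongly_bisimilar_spec_pda[OF E(2)]] by blast
  with pushdown_automaton_spec_pda[OF E(1,2)] show ?thesis by blast
qed

end
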